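(* Let $R$ be a commutative ring with $1\neq 0$. Then $\widetilde{\Gamma}(R)=\Gamma(R)$ if and only if $\Gamma(R)$ is complete.
   Context: For a commutative ring $R$ with $1\neq 0$, $Z(R)$ denotes the set of zero-divisors of $R$ (including $0$) and $Z(R)^{\star}=Z(R)\setminus\{0\}$. All graphs here are undirected simple graphs with vertex set $Z(R)^{\star}$. In the zero-divisor graph $\Gamma(R)$, distinct vertices $x,y$ are adjacent if and only if $xy=0$. In $\widetilde{\Gamma}(R)$, distinct vertices $x,y$ are adjacent if and only if $xy=0$ or $x+y\in Z(R)$. Equality of graphs means they have the same edges. A graph is complete if any two distinct vertices are adjacent; a graph with $0$ or $1$ vertices is regarded as complete. *)

theory Defs
  imports "HOL-Algebra.Ring" "HOL-Library.Ramsey"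
begin

text \<open>
  A simple graph is a pair of a vertex set and a set of edges, each edge being an unordered
  pair of distinct vertices; this is the representation that \<^const>\<open>clique\<close> works with.
  Graphs may be infinite.
\<close>

type_synonym 'a graph = "'a set \<times> 'a set set"

definition simple_graph :: "'a set \<Rightarrow> ('a \<Rightarrow> 'a \<Rightarrow> bool) \<Rightarrow> 'a graph"
  where "simple_graph V adj = (V, {{x, y} | x y. x \<in> V \<and> y \<in> V \<and> x \<noteq> y \<and> adj x y})"

definition complete_graph :: "'a graph \<Rightarrow> bool"
  where "complete_graph G \<longleftrightarrow> clique (fst G) (snd G)"

definition zero_divisors :: "('a, 'b) ring_scheme \<Rightarrow> 'a set"
  where "zero_divisors R =
    {x \<in> carrier R. \<exists>y \<in> carrier R. y \<noteq> \<zero>\<^bsub>R\<^esub> \<and> x \<otimes>\<^bsub>R\<^esub> y = \<zero>\<^bsub>R\<^esub>}"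

definition nonzero_zero_divisors :: "('a, 'b) ring_scheme \<Rightarrow> 'a set"
  where "nonzero_zero_divisors R = zero_divisors R - {\<zero>\<^bsub>R\<^esub>}"

definition zero_divisor_graph :: "('a, 'b) ring_scheme \<Rightarrow> 'a graph"
  where "zero_divisor_graph R =
    simple_graph (nonzero_zero_divisors R) (\<lambda>x y. x \<otimes>\<^bsub>R\<^esub> y = \<zero>\<^bsub>R\<^esub>)"

definition extended_zero_divisor_graph :: "('a, 'b) ring_scheme \<Rightarrow> 'a graph"
  where "extended_zero_divisor_graph R =
    simple_graph (nonzero_zero_divisors R)
      (\<lambda>x y. x \<otimes>\<^bsub>R\<^esub> y = \<zero>\<^bsub>R\<^esub> \<or> x \<oplus>\<^bsub>R\<^esub> y \<in> zero_divisors R)"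

lemma zero_in_zero_divisors:
  assumes "cring R" "\<one>\<^bsub>R\<^esub> \<noteq> \<zero>\<^bsub>R\<^esub>"
  shows "\<zero>\<^bsub>R\<^esub> \<in> zero_divisors R"
proof -
  interpret cring R by fact
  show ?thesis using assms(2) by (auto simp: zero_divisors_def intro: bexI[of _ "\<one>\<^bsub>R\<^esub>"])
qed

text \<open>
  The edge set determines adjacency when the relation is symmetric, as it is for both graphs above.
\<close>

lemma edge_simple_graph_iff:
  assumes "\<And>x y. x \<in> V \<Longrightarrow> y \<in> V \<Longrightarrow> adj x y \<Longrightarrow> adj y x"
  shows "{x, y} \<in> snd (simple_graph V adj) \<longleftrightarrow> x \<in> V \<and> y \<in> V \<and> x \<noteq> y \<and> adj x y"
  using assms unfolding simple_graph_def by (auto simp: doubleton_eq_iff)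

end

theory Submission
  imports Defs
begin

text \<open>
  Suppose that \<open>x + y\<close> being a zero-divisor forces \<open>xy = 0\<close> for distinct \<open>x, y\<close>. Since \<open>x + xy\<close> is
  a multiple of \<open>x\<close>, either \<open>xy = x\<close> or \<open>x\<^sup>2y = 0\<close>, and likewise \<open>xy = y\<close> or \<open>xy\<^sup>2 = 0\<close>. If
  \<open>xy \<noteq> 0\<close> for distinct \<open>x, y\<close>, then only \<open>x\<^sup>2y = xy\<^sup>2 = 0\<close> is possible, so \<open>xy\<close> annihilates
  \<open>x + y\<close>, and \<open>xy = 0\<close> after all.
\<close>

lemma (in cring) zero_divisors_mult:
  assumes "x \<in> zero_divisors R" "a \<in> carrier R"
  shows "x \<otimes> a \<in> zero_divisors R"
proof -
  from assms(1) obtain z where x: "x \<in> carrier R"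
    and z: "z \<in> carrier R" "z \<noteq> \<zero>" "x \<otimes> z = \<zero>"
    by (auto simp: zero_divisors_def)
  have "(x \<otimes> a) \<otimes> z = a \<otimes> (x \<otimes> z)"
    using x z(1) assms(2) by (simp add: m_ac)
  then show ?thesis
    using x z assms(2) by (auto simp: zero_divisors_def)
qed

text \<open>Apply \<open>imp\<close> to the pair \<open>x\<close>, \<open>x \<otimes> a\<close>: the
  last two assumptions make the second entry a vertex distinct from the first, and the sum factors
  as \<open>x \<otimes> (\<one> \<oplus> a)\<close>.\<close>

lemma (in cring) mult_self_mult_eq_zero:
  assumes imp: "\<And>u v. \<lbrakk>u \<in> nonzero_zero_divisors R; v \<in> nonzero_zero_divisors R; u \<noteq> v;
      u \<oplus> v \<in> zero_divisors R\<rbrakk> \<Longrightarrow> u \<otimes> v = \<zero>"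
    and x: "x \<in> nonzero_zero_divisors R" and a: "a \<in> carrier R"
    and "x \<otimes> a \<noteq> \<zero>" "x \<otimes> a \<noteq> x"
  shows "x \<otimes> (x \<otimes> a) = \<zero>"
proof (rule imp)
  have xZ: "x \<in> zero_divisors R" and xR: "x \<in> carrier R"
    using x by (auto simp: nonzero_zero_divisors_def zero_divisors_def)
  show "x \<otimes> a \<in> nonzero_zero_divisors R"
    using zero_divisors_mult[OF xZ a] assms(4) by (simp add: nonzero_zero_divisors_def)
  have "x \<oplus> x \<otimes> a = x \<otimes> (\<one> \<oplus> a)"
    using xR a by (simp add: r_distr)
  then show "x \<oplus> x \<otimes> a \<in> zero_divisors R"
    using zero_divisors_mult[OF xZ, of "\<one> \<oplus> a"] a by simp
qed (use x assms(5) in auto)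

lemma (in cring) mult_eq_zero_if_add_zero_divisor_imp:
  assumes imp: "\<And>u v. \<lbrakk>u \<in> nonzero_zero_divisors R; v \<in> nonzero_zero_divisors R; u \<noteq> v;
      u \<oplus> v \<in> zero_divisors R\<rbrakk> \<Longrightarrow> u \<otimes> v = \<zero>"
    and x: "x \<in> nonzero_zero_divisors R" and y: "y \<in> nonzero_zero_divisors R" and "x \<noteq> y"
  shows "x \<otimes> y = \<zero>"
proof (rule ccontr)
  assume ne: "x \<otimes> y \<noteq> \<zero>"
  have R: "x \<in> carrier R" "y \<in> carrier R"
    using x y by (auto simp: nonzero_zero_divisors_def zero_divisors_def)
  have yx: "y \<otimes> x = x \<otimes> y"
    using R by (simp add: m_comm)
  have xxy: "x \<otimes> (x \<otimes> y) = \<zero>" if "x \<otimes> y \<noteq> x"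
    using mult_self_mult_eq_zero[OF imp x R(2) ne that] .
  have yxy: "y \<otimes> (x \<otimes> y) = \<zero>" if "x \<otimes> y \<noteq> y"
    using mult_self_mult_eq_zero[OF imp y R(1)] ne that by (simp add: yx)
  \<comment> \<open>If \<open>x \<otimes> y = x\<close>, then
    \<open>x \<otimes> y \<noteq> y\<close> because \<open>x \<noteq> y\<close>, so
    \<open>yxy\<close> applies and collapses to \<open>y \<otimes> x = \<zero>\<close>. The other
    case is symmetric.\<close>
  have "x \<otimes> y \<noteq> x"
  proof
    assume "x \<otimes> y = x"
    then show False
      using yxy ne \<open>x \<noteq> y\<close> yx by simp
  qed
  moreover have "x \<otimes> y \<noteq> y"
  proof
    assume "x \<otimes> y = y"
    then show False
      using xxy ne \<open>x \<noteq> y\<close> by simp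
  qed
  ultimately have "(x \<oplus> y) \<otimes> (x \<otimes> y) = \<zero>"
    using R xxy yxy by (simp add: l_distr)
  \<comment> \<open>The nonzero annihilator is \<open>x \<otimes> y\<close> itself.\<close>
  then have "x \<oplus> y \<in> zero_divisors R"
    using R ne by (auto simp: zero_divisors_def)
  then show False
    using imp[OF x y \<open>x \<noteq> y\<close>] ne by blast
qed

theorem theorem2p3:
  fixes R :: "('a, 'b) ring_scheme"
  assumes "cring R"
    and "\<one>\<^bsub>R\<^esub> \<noteq> \<zero>\<^bsub>R\<^esub>"
  shows "extended_zero_divisor_graph R = zero_divisor_graph R
    \<longleftrightarrow> complete_graph (zero_divisor_graph R)"
proof -
  interpret cring R by fact
  let ?Z = "nonzero_zero_divisors R"
  have carr: "x \<in> carrier R" if "x \<in> ?Z" for x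
    using that by (simp add: nonzero_zero_divisors_def zero_divisors_def)
  have edge: "{x, y} \<in> snd (zero_divisor_graph R) \<longleftrightarrow> x \<in> ?Z \<and> y \<in> ?Z \<and> x \<noteq> y \<and> x \<otimes>\<^bsub>R\<^esub> y = \<zero>\<^bsub>R\<^esub>"
    for x y
    unfolding zero_divisor_graph_def
    \<comment> \<open>The remaining goal is symmetry of adjacency, which is commutativity on the
      carrier.\<close>
    by (rule edge_simple_graph_iff) (simp add: carr m_comm)
  have edge_ext: "{x, y} \<in> snd (extended_zero_divisor_graph R) \<longleftrightarrow>
      x \<in> ?Z \<and> y \<in> ?Z \<and> x \<noteq> y \<and> (x \<otimes>\<^bsub>R\<^esub> y = \<zero>\<^bsub>R\<^esub> \<or> x \<oplus>\<^bsub>R\<^esub> y \<in> zero_divisors R)" for x y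
    unfolding extended_zero_divisor_graph_def
    by (rule edge_simple_graph_iff) (auto simp: carr m_comm a_comm)
  have complete: "complete_graph (zero_divisor_graph R) \<longleftrightarrow>
      (\<forall>x \<in> ?Z. \<forall>y \<in> ?Z. x \<noteq> y \<longrightarrow> x \<otimes>\<^bsub>R\<^esub> y = \<zero>\<^bsub>R\<^esub>)"
    unfolding complete_graph_def clique_def edge
    by (auto simp: zero_divisor_graph_def simple_graph_def)
  show ?thesis
  proof
    assume eq: "extended_zero_divisor_graph R = zero_divisor_graph R"
    have imp: "u \<otimes>\<^bsub>R\<^esub> v = \<zero>\<^bsub>R\<^esub>"
      if "u \<in> ?Z" "v \<in> ?Z" "u \<noteq> v" "u \<oplus>\<^bsub>R\<^esub> v \<in> zero_divisors R" for u v
      \<comment> \<open>Rewriting with \<open>eq\<close> makes both characterisations describe the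
        same edge set, so the sum condition must yield the product condition.\<close>
      using edge[of u v] edge_ext[of u v, unfolded eq] that by blast
    then show "complete_graph (zero_divisor_graph R)"
      unfolding complete
      by (intro ballI impI) (rule mult_eq_zero_if_add_zero_divisor_imp[OF imp])
  next
    assume "complete_graph (zero_divisor_graph R)"
    \<comment> \<open>With every product of distinct vertices zero, the extra disjunct can add no
      edge.\<close>
    then have "x \<otimes>\<^bsub>R\<^esub> y = \<zero>\<^bsub>R\<^esub>" if "x \<in> ?Z" "y \<in> ?Z" "x \<noteq> y" for x y
      using that by (simp only: complete) blast
    then show "extended_zero_divisor_graph R = zero_divisor_graph R"
      unfolding extended_zero_divisor_graph_def zero_divisor_graph_def simple_graph_def
      by blast
  qed
qed

end
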